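(* Let $\mathcal I$ be an ideal on $\mathbb N$ such that $\mathcal I\upharpoonright C$ is not a maximal ideal for every $C\in \mathcal I^+$ (i.e. every set from $\mathcal I^+$ can be divided into two disjoint sets from $\mathcal I^+$). Then the following conditions are equivalent. (1) $AOS(\mathcal I)\neq\emptyset$. (2) $AOS(\mathcal I^* )\neq\emptyset$. (3) $AOS(\mathcal I)$ is $\mathfrak c$-lineable. (4) $AOS(\mathcal I^* )$ is $\mathfrak c$-lineable. (5) $AOS(\mathcal I)$ is spaceable. (6) $AOS(\mathcal I^* )$ is spaceable. (7) $\mathcal I_{1/n}\cap \mathcal I^+\neq \emptyset$.
   Context: $\mathbb N=\{1,2,\dots\}$; $\mathfrak c$ is the cardinality of the continuum. An ideal on $\mathbb N$ (and similarly on any infinite countable set in place of $\mathbb N$) is a nonempty family $\mathcal I\subseteq\mathcal P(\mathbb N)$ closed under subsets and finite unions, containing all finite subsets of $\mathbb N$, with $\mathbb N\notin\mathcal I$. $\mathcal I^*=\{\mathbb N\setminus A: A\in\mathcal I\}$ is the dual filter and $\mathcal I^+=\{A\subseteq\mathbb N:A\notin\mathcal I\}$ is the coideal. An ideal is maximal if its coideal equals its dual filter. For $C\in\mathcal I^+$, $\mathcal I\upharpoonright C=\{A\cap C:A\in\mathcal I\}$, an ideal on $C$. $\mathcal I_{1/n}=\{A\subseteq\mathbb N:\sum_{n\in A}\frac1n<\infty\}$ is the summable ideal. For a real sequence $(x_n)$: $(x_n)$ is $\mathcal I$-convergent to $0$ if $\{n:|x_n|\ge\varepsilon\}\in\mathcal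 I$ for every $\varepsilon>0$; it is $\mathcal I^*$-convergent to $0$ if there is $F\in\mathcal I^*$ such that the subsequence $(x_n)_{n\in F}$ converges to $0$ in the ordinary sense. $\ell_1$ is the Banach space of real sequences with absolutely convergent series, with norm $\lVert(a_n)\rVert=\sum_{n=1}^\infty|a_n|$. $AOS(\mathcal I)$ (resp. $AOS(\mathcal I^* )$) is the set of all $(a_n)\in\ell_1$ such that $(na_n)$ is not $\mathcal I$-convergent (resp. not $\mathcal I^*$-convergent) to zero. A subset $Y\subseteq\ell_1$ is $\kappa$-lineable if $Y\cup\{0\}$ contains a vector subspace of dimension $\kappa$, and spaceable if $Y\cup\{0\}$ contains a closed infinite-dimensional vector subspace. *)

theory Defs
  imports "HOL-Analysis.Analysis"
begin

section \<open>Ideals\<close>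

text \<open>Ground sets are sets of natural numbers; the ambient one is \<open>\<nat> = {1, 2, \<dots>}\<close>,
  written \<^term>\<open>{1::nat..}\<close>.\<close>

definition ideal_on :: "nat set \<Rightarrow> nat set set \<Rightarrow> bool" where
  "ideal_on X I \<longleftrightarrow>
     I \<noteq> {} \<and> I \<subseteq> Pow X \<and>
     (\<forall>A\<in>I. \<forall>B. B \<subseteq> A \<longrightarrow> B \<in> I) \<and>
     (\<forall>A\<in>I. \<forall>B\<in>I. A \<union> B \<in> I) \<and>
     (\<forall>A. finite A \<and> A \<subseteq> X \<longrightarrow> A \<in> I) \<and>
     X \<notin> I"

definition dual_filter :: "nat set \<Rightarrow> nat set set \<Rightarrow> nat set set" where
  "dual_filter X I = {X - A |A. A \<in> I}"

definition coideal :: "nat set \<Rightarrow> nat set set \<Rightarrow> nat set set" where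
  "coideal X I = {A. A \<subseteq> X \<and> A \<notin> I}"

definition maximal_ideal :: "nat set \<Rightarrow> nat set set \<Rightarrow> bool" where
  "maximal_ideal X I \<longleftrightarrow> ideal_on X I \<and> coideal X I = dual_filter X I"

definition restrict_ideal :: "nat set set \<Rightarrow> nat set \<Rightarrow> nat set set" where
  "restrict_ideal I C = {A \<inter> C |A. A \<in> I}"

definition summable_ideal :: "nat set set" where
  "summable_ideal = {A. A \<subseteq> {1..} \<and> (\<lambda>n. 1 / real n) summable_on A}"

section \<open>Ideal convergence\<close>

text \<open>A sequence \<open>(x\<^sub>n)\<close> with indices \<open>n \<ge> 1\<close> is a function on \<^typ>\<open>nat\<close> whose value
  at \<open>0\<close> is never inspected.\<close>

definition ideal_null :: "nat set set \<Rightarrow> (nat \<Rightarrow> real) \<Rightarrow> bool" where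
  "ideal_null I x \<longleftrightarrow> (\<forall>\<epsilon>>0. {n\<in>{1..}. \<bar>x n\<bar> \<ge> \<epsilon>} \<in> I)"

text \<open>The members of the dual filter of an ideal are infinite, so \<^const>\<open>enumerate\<close> lists
  them increasingly.\<close>

definition ideal_star_null :: "nat set set \<Rightarrow> (nat \<Rightarrow> real) \<Rightarrow> bool" where
  "ideal_star_null I x \<longleftrightarrow> (\<exists>F\<in>dual_filter {1..} I. (\<lambda>k. x (enumerate F k)) \<longlonglongrightarrow> 0)"

section \<open>The normed space of absolutely summable sequences\<close>

text \<open>Sequences are indexed by \<open>1, 2, \<dots>\<close>; the unused value at \<open>0\<close> is normalised to zero.\<close>

typedef ell1 = "{a :: nat \<Rightarrow> real. a 0 = 0 \<and> summable (\<lambda>n. \<bar>a n\<bar>)}"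
  morphisms seq Abs_ell1
  by (rule exI[of _ "\<lambda>_. 0"]) simp

setup_lifting type_definition_ell1

lemma seq_0 [simp]: "seq a 0 = 0"
  and summable_abs_seq: "summable (\<lambda>n. \<bar>seq a n\<bar>)"
  using seq[of a] by auto

lemma ell1_eqI: "(\<And>n. seq a n = seq b n) \<Longrightarrow> a = b"
  by (simp add: seq_inject[symmetric] fun_eq_iff)

instantiation ell1 :: real_vector
begin

lift_definition zero_ell1 :: ell1 is "\<lambda>_. 0"
  by simp

lift_definition plus_ell1 :: "ell1 \<Rightarrow> ell1 \<Rightarrow> ell1" is "\<lambda>a b n. a n + b n"
proof -
  fix a b :: "nat \<Rightarrow> real"
  assume ab: "a 0 = 0 \<and> summable (\<lambda>n. \<bar>a n\<bar>)" "b 0 = 0 \<and> summable (\<lambda>n. \<bar>b n\<bar>)"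
  have "summable (\<lambda>n. \<bar>a n + b n\<bar>)"
    by (rule summable_comparison_test'[where N = 0 and g = "\<lambda>n. \<bar>a n\<bar> + \<bar>b n\<bar>"])
      (use ab in \<open>simp_all add: summable_add abs_triangle_ineq\<close>)
  with ab show "a 0 + b 0 = 0 \<and> summable (\<lambda>n. \<bar>a n + b n\<bar>)"
    by simp
qed

lift_definition uminus_ell1 :: "ell1 \<Rightarrow> ell1" is "\<lambda>a n. - a n"
  by simp

lift_definition minus_ell1 :: "ell1 \<Rightarrow> ell1 \<Rightarrow> ell1" is "\<lambda>a b n. a n - b n"
proof -
  fix a b :: "nat \<Rightarrow> real"
  assume ab: "a 0 = 0 \<and> summable (\<lambda>n. \<bar>a n\<bar>)" "b 0 = 0 \<and> summable (\<lambda>n. \<bar>b n\<bar>)"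
  have "summable (\<lambda>n. \<bar>a n - b n\<bar>)"
    by (rule summable_comparison_test'[where N = 0 and g = "\<lambda>n. \<bar>a n\<bar> + \<bar>b n\<bar>"])
      (use ab in \<open>simp_all add: summable_add abs_triangle_ineq4\<close>)
  with ab show "a 0 - b 0 = 0 \<and> summable (\<lambda>n. \<bar>a n - b n\<bar>)"
    by simp
qed

lift_definition scaleR_ell1 :: "real \<Rightarrow> ell1 \<Rightarrow> ell1" is "\<lambda>c a n. c * a n"
  by (simp add: abs_mult)

instance
  by standard
    (auto intro!: ell1_eqI simp: zero_ell1.rep_eq plus_ell1.rep_eq uminus_ell1.rep_eq
      minus_ell1.rep_eq scaleR_ell1.rep_eq algebra_simps)

end

lemma seq_zero [simp]: "seq 0 n = 0"
  and seq_add [simp]: "seq (a + b) n = seq a n + seq b n"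
  and seq_uminus [simp]: "seq (- a) n = - seq a n"
  and seq_diff [simp]: "seq (a - b) n = seq a n - seq b n"
  and seq_scaleR [simp]: "seq (c *\<^sub>R a) n = c * seq a n"
  by (simp_all add: zero_ell1.rep_eq plus_ell1.rep_eq uminus_ell1.rep_eq
      minus_ell1.rep_eq scaleR_ell1.rep_eq)

instantiation ell1 :: real_normed_vector
begin

definition norm_ell1 :: "ell1 \<Rightarrow> real" where
  "norm a = (\<Sum>n. \<bar>seq a n\<bar>)" for a :: ell1

definition dist_ell1 :: "ell1 \<Rightarrow> ell1 \<Rightarrow> real" where
  "dist a b = norm (a - b)" for a b :: ell1

definition sgn_ell1 :: "ell1 \<Rightarrow> ell1" where
  "sgn a = inverse (norm a) *\<^sub>R a" for a :: ell1

definition uniformity_ell1 :: "(ell1 \<times> ell1) filter" where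
  "uniformity_ell1 = (INF e\<in>{0<..}. principal {(x, y). dist x y < e})"

definition open_ell1 :: "ell1 set \<Rightarrow> bool" where
  "open_ell1 U \<longleftrightarrow> (\<forall>x\<in>U. eventually (\<lambda>(x', y). x' = x \<longrightarrow> y \<in> U) uniformity)"

instance
proof
  fix a b :: ell1 and c :: real
  show "norm a = 0 \<longleftrightarrow> a = 0"
    using suminf_eq_zero_iff[OF summable_abs_seq[of a]]
    by (auto simp: norm_ell1_def intro!: ell1_eqI)
  have "norm (a + b) \<le> (\<Sum>n. \<bar>seq a n\<bar> + \<bar>seq b n\<bar>)"
    unfolding norm_ell1_def
    by (intro suminf_le summable_abs_seq summable_add) simp
  also have "\<dots> = norm a + norm b"
    unfolding norm_ell1_def by (simp add: suminf_add summable_abs_seq)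
  finally show "norm (a + b) \<le> norm a + norm b" .
  show "norm (c *\<^sub>R a) = \<bar>c\<bar> * norm a"
    by (simp add: norm_ell1_def abs_mult suminf_mult summable_abs_seq)
qed (rule dist_ell1_def sgn_ell1_def uniformity_ell1_def open_ell1_def)+

end

definition AOS :: "nat set set \<Rightarrow> ell1 set" where
  "AOS I = {a. \<not> ideal_null I (\<lambda>n. real n * seq a n)}"

definition AOS_star :: "nat set set \<Rightarrow> ell1 set" where
  "AOS_star I = {a. \<not> ideal_star_null I (\<lambda>n. real n * seq a n)}"

section \<open>Lineability and spaceability\<close>

text \<open>The cardinal \<open>\<kappa>\<close> is given by a representing set \<open>K\<close>, of any type.\<close>

definition lineable :: "'k set \<Rightarrow> 'a::real_vector set \<Rightarrow> bool" where
  "lineable K Y \<longleftrightarrow>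
     (\<exists>V B. subspace V \<and> V \<subseteq> Y \<union> {0} \<and> independent B \<and> span B = V \<and> B \<approx> K)"

definition spaceable :: "'a::real_normed_vector set \<Rightarrow> bool" where
  "spaceable Y \<longleftrightarrow>
     (\<exists>V. subspace V \<and> closed V \<and> V \<subseteq> Y \<union> {0} \<and> \<not> (\<exists>B. finite B \<and> span B = V))"

end

theory Submission
  imports Defs
begin

text \<open>If \<open>a \<in> \<ell>\<^sub>1\<close> has tails \<open>r\<^sub>n\<close>, the set where \<open>n\<bar>a\<^sub>n\<bar> > \<surd>r\<^sub>n\<close> lies in the summable ideal,
  because \<open>\<bar>a\<^sub>n\<bar> \<le> 2\<surd>r\<^sub>n(\<surd>r\<^sub>n - \<surd>r\<^bsub>n+1\<^esub>)\<close> and the last factor telescopes; off this set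
  \<open>n a\<^sub>n \<rightarrow> 0\<close>. So if every set of the summable ideal is in \<open>I\<close>, even \<open>AOS_star I\<close> is empty.

  Conversely, split a positive set \<open>C\<close> of the summable ideal into infinitely many positive pieces
  \<open>C\<^sub>k\<close>. The sequences \<open>a\<close> supported on their union for which \<open>n a\<^sub>n\<close> is constant on each piece form
  a closed subspace, and each nonzero one lies in \<open>AOS I\<close>. An almost disjoint family of continuum
  many sets of indices \<open>k\<close> provides continuum many linearly independent members.\<close>

section \<open>Ideals and the two notions of ideal convergence\<close>

lemma ideal_subset: "ideal_on X I \<Longrightarrow> A \<in> I \<Longrightarrow> B \<subseteq> A \<Longrightarrow> B \<in> I"
  and ideal_Un: "ideal_on X I \<Longrightarrow> A \<in> I \<Longrightarrow> B \<in> I \<Longrightarrow> A \<union> B \<in> I"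
  and ideal_finite: "ideal_on X I \<Longrightarrow> finite A \<Longrightarrow> A \<subseteq> X \<Longrightarrow> A \<in> I"
  and ideal_proper: "ideal_on X I \<Longrightarrow> X \<notin> I"
  unfolding ideal_on_def by blast+

lemma infinite_dual_filter:
  assumes "ideal_on X I" "F \<in> dual_filter X I"
  shows "infinite F"
proof
  assume "finite F"
  obtain A where A: "A \<in> I" "F = X - A"
    using assms(2) by (auto simp: dual_filter_def)
  have "A \<union> F \<in> I"
    using ideal_Un[OF assms(1) A(1)] ideal_finite[OF assms(1) \<open>finite F\<close>] A(2) by blast
  then have "X \<in> I"
    using A(2) by (blast intro: ideal_subset[OF assms(1)])
  with assms(1) show False
    by (simp add: ideal_proper)
qed

text \<open>Values of size at least \<epsilon> occur only on the exceptional set \<open>A\<close> or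
  among finitely many terms of the enumeration of \<open>F\<close>, and finite sets belong to the
  ideal.\<close>

lemma ideal_star_null_imp_ideal_null:
  assumes I: "ideal_on {1..} I" and x: "ideal_star_null I x"
  shows "ideal_null I x"
  unfolding ideal_null_def
proof (intro allI impI)
  fix \<epsilon> :: real
  assume "\<epsilon> > 0"
  obtain F where F: "F \<in> dual_filter {1..} I" and lim: "(\<lambda>k. x (enumerate F k)) \<longlonglongrightarrow> 0"
    using x by (auto simp: ideal_star_null_def)
  obtain A where A: "A \<in> I" "F = {1..} - A"
    using F by (auto simp: dual_filter_def)
  obtain N where N: "\<And>k. k \<ge> N \<Longrightarrow> \<bar>x (enumerate F k)\<bar> < \<epsilon>"
    using LIMSEQ_D[OF lim \<open>\<epsilon> > 0\<close>] by auto
  have inf: "infinite F"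
    by (rule infinite_dual_filter[OF I F])
  have sub: "{n \<in> {1..}. \<bar>x n\<bar> \<ge> \<epsilon>} \<subseteq> A \<union> enumerate F ` {..<N}"
  proof
    fix n
    assume n: "n \<in> {n \<in> {1..}. \<bar>x n\<bar> \<ge> \<epsilon>}"
    show "n \<in> A \<union> enumerate F ` {..<N}"
    proof (cases "n \<in> A")
      case False
      then have "n \<in> F"
        using n A(2) by auto
      then obtain k where k: "n = enumerate F k"
        using enumerate_Ex[of F n] inf by metis
      then have "k < N"
        using N[of k] n by (auto simp: not_le[symmetric])
      with k show ?thesis
        by auto
    qed auto
  qed
  have "enumerate F ` {..<N} \<subseteq> {1..}"
    using enumerate_in_set[OF inf] A(2) by auto
  then have "A \<union> enumerate F ` {..<N} \<in> I"
    by (intro ideal_Un[OF I A(1)] ideal_finite[OF I]) auto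
  then show "{n \<in> {1..}. \<bar>x n\<bar> \<ge> \<epsilon>} \<in> I"
    by (rule ideal_subset[OF I _ sub])
qed

lemma AOS_subset_AOS_star: "ideal_on {1..} I \<Longrightarrow> AOS I \<subseteq> AOS_star I"
  by (auto simp: AOS_def AOS_star_def intro: ideal_star_null_imp_ideal_null)

section \<open>A positive set in the summable ideal from a member of
  \<open>AOS_star I\<close>\<close>

lemma AOS_star_imp_summable_positive:
  assumes I: "ideal_on {1..} I" and "AOS_star I \<noteq> {}"
  shows "summable_ideal \<inter> coideal {1..} I \<noteq> {}"
proof -
  obtain a where a: "\<not> ideal_star_null I (\<lambda>n. real n * seq a n)"
    using assms(2) by (auto simp: AOS_star_def)
  \<comment> \<open>The tail includes index \<open>n\<close> itself, so consecutive tails differ by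
    exactly \<open>\<bar>seq a n\<bar>\<close>.\<close>
  define r where "r n = (\<Sum>i. \<bar>seq a (i + n)\<bar>)" for n
  have r_eq: "r n = suminf (\<lambda>i. \<bar>seq a i\<bar>) - (\<Sum>i<n. \<bar>seq a i\<bar>)" for n
    unfolding r_def by (rule suminf_minus_initial_segment[OF summable_abs_seq])
  have r_lim: "r \<longlonglongrightarrow> 0"
    using tendsto_diff[OF tendsto_const summable_LIMSEQ[OF summable_abs_seq[of a]],
        of "suminf (\<lambda>i. \<bar>seq a i\<bar>)"]
    by (simp add: r_eq[abs_def])
  have r_step: "\<bar>seq a n\<bar> = r n - r (Suc n)" for n
    by (simp add: r_eq)
  have r_nonneg: "r n \<ge> 0" for n
    unfolding r_def using summable_abs_seq[of a]
    by (intro suminf_nonneg) (simp_all add: summable_iff_shift[of "\<lambda>i. \<bar>seq a i\<bar>"])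
  have r_dec: "r (Suc n) \<le> r n" for n
    using r_step[of n] by linarith
  have sqrt_lim: "(\<lambda>n. sqrt (r n)) \<longlonglongrightarrow> 0"
    using tendsto_real_sqrt[OF r_lim] by simp
  define A where "A = {n \<in> {1..}. sqrt (r n) < \<bar>real n * seq a n\<bar>}"
  \<comment> \<open>The factor 2 pays for replacing the sum of two consecutive roots by twice the
    larger one; the series of \<open>g\<close> telescopes.\<close>
  define g where "g n = 2 * (sqrt (r n) - sqrt (r (Suc n)))" for n
  have g_nonneg: "g n \<ge> 0" for n
    using r_dec[of n] by (simp add: g_def)
  have "summable g"
    unfolding g_def by (intro summable_mult telescope_summable'[OF sqrt_lim])
  then have "g summable_on UNIV"
    by (simp add: summable_on_UNIV_nonneg_real_iff g_nonneg)
  then have g_A: "g summable_on A"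
    by (rule summable_on_subset_banach) simp
  have le_g: "1 / real n \<le> g n" if "n \<in> A" for n
  proof -
    have n: "n \<ge> 1" "sqrt (r n) < real n * \<bar>seq a n\<bar>"
      using that by (auto simp: A_def abs_mult)
    \<comment> \<open>The strict inequality defining \<open>A\<close> rules out a zero term, so
      \<open>r n\<close> is positive and its root can be cancelled below.\<close>
    have "seq a n \<noteq> 0"
      using n(2) r_nonneg[of n] by auto
    then have pos: "sqrt (r n) > 0"
      using r_step[of n] r_nonneg[of "Suc n"] by simp
    have "\<bar>seq a n\<bar> = (sqrt (r n) + sqrt (r (Suc n))) * (sqrt (r n) - sqrt (r (Suc n)))"
      using r_step[of n] r_nonneg by (simp add: algebra_simps)
    also have "\<dots> \<le> (2 * sqrt (r n)) * (sqrt (r n) - sqrt (r (Suc n)))"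
      using r_dec[of n] by (intro mult_right_mono) auto
    also have "\<dots> = sqrt (r n) * g n"
      by (simp add: g_def)
    finally have "real n * \<bar>seq a n\<bar> \<le> real n * (sqrt (r n) * g n)"
      by (rule mult_left_mono) simp
    with n(2) have "sqrt (r n) * 1 < sqrt (r n) * (real n * g n)"
      by (simp add: algebra_simps)
    then have "1 < real n * g n"
      using pos by (subst (asm) mult_less_cancel_left_pos)
    then show ?thesis
      using n(1) by (simp add: field_simps)
  qed
  have "(\<lambda>n. 1 / real n) summable_on A"
    by (rule summable_on_comparison_test[OF g_A]) (use le_g in auto)
  then have "A \<in> summable_ideal"
    by (auto simp: summable_ideal_def A_def)
  moreover have "A \<notin> I"
  proof
    assume "A \<in> I"
    then have F: "{1..} - A \<in> dual_filter {1..} I"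
      by (auto simp: dual_filter_def)
    \<comment> \<open>Over an infinite set \<open>enumerate\<close> is strictly increasing, so the
      limit of \<open>sqrt (r n)\<close> passes to the subsequence.\<close>
    have inf: "infinite ({1..} - A)"
      by (rule infinite_dual_filter[OF I F])
    let ?e = "enumerate ({1..} - A)"
    have "\<bar>real (?e k) * seq a (?e k)\<bar> \<le> sqrt (r (?e k))" for k
      using enumerate_in_set[OF inf, of k] by (auto simp: A_def)
    moreover have "(\<lambda>k. sqrt (r (?e k))) \<longlonglongrightarrow> 0"
      using LIMSEQ_subseq_LIMSEQ[OF sqrt_lim strict_mono_enumerate[OF inf]] by (simp add: o_def)
    ultimately have "(\<lambda>k. real (?e k) * seq a (?e k)) \<longlonglongrightarrow> 0"
      using Lim_null_comparison[of "\<lambda>k. real (?e k) * seq a (?e k)" "\<lambda>k. sqrt (r (?e k))"]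
      by (simp add: always_eventually)
    with F a show False
      by (auto simp: ideal_star_null_def)
  qed
  ultimately show ?thesis
    by (auto simp: coideal_def A_def)
qed

section \<open>Splitting positive sets\<close>

text \<open>For a proper ideal the dual filter lies inside the coideal. Non-maximality makes this
  inclusion strict, and any set in the gap is one half of a splitting.\<close>

lemma split_positive:
  assumes I: "ideal_on X I" and C: "C \<in> coideal X I"
    and "\<not> maximal_ideal C (restrict_ideal I C)"
  obtains D where "D \<subseteq> C" "D \<in> coideal X I" "C - D \<in> coideal X I"
proof -
  have C': "C \<subseteq> X" "C \<notin> I"
    using C by (auto simp: coideal_def)
  have R: "restrict_ideal I C = {A \<in> I. A \<subseteq> C}"
    unfolding restrict_ideal_def using ideal_subset[OF I] by blast
  have "ideal_on C (restrict_ideal I C)"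
    unfolding ideal_on_def R
  proof (intro conjI ballI allI impI)
    show "{A \<in> I. A \<subseteq> C} \<noteq> {}"
      using ideal_finite[OF I, of "{}"] by auto
    show "B \<in> {A \<in> I. A \<subseteq> C}" if "A \<in> {A \<in> I. A \<subseteq> C}" "B \<subseteq> A" for A B
      using that ideal_subset[OF I, of A B] by auto
    show "A \<union> B \<in> {A \<in> I. A \<subseteq> C}"
      if "A \<in> {A \<in> I. A \<subseteq> C}" "B \<in> {A \<in> I. A \<subseteq> C}" for A B
      using that ideal_Un[OF I, of A B] by auto
    show "A \<in> {A \<in> I. A \<subseteq> C}" if "finite A \<and> A \<subseteq> C" for A
      using that C'(1) ideal_finite[OF I, of A] by auto
  qed (use C'(2) in auto)
  then have "coideal C (restrict_ideal I C) \<noteq> dual_filter C (restrict_ideal I C)"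
    using assms(3) by (simp add: maximal_ideal_def)
  moreover have "dual_filter C (restrict_ideal I C) \<subseteq> coideal C (restrict_ideal I C)"
  proof -
    have "C - A \<notin> I" if "A \<in> I" "A \<subseteq> C" for A
      using ideal_Un[OF I that(1), of "C - A"] that C'(2) by (auto simp: Un_absorb1)
    then show ?thesis
      by (auto simp: dual_filter_def coideal_def R)
  qed
  ultimately obtain D where "D \<subseteq> C" "D \<notin> I" "D \<notin> dual_filter C (restrict_ideal I C)"
    by (auto simp: coideal_def R)
  \<comment> \<open>Otherwise \<open>D\<close>, the complement of \<open>C - D\<close> in
    \<open>C\<close>, would lie in the dual filter.\<close>
  moreover from this have "C - D \<notin> I"
    by (auto simp: dual_filter_def R double_diff)
  ultimately show thesis
    using C'(1) by (intro that[of D]) (auto simp: coideal_def)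
qed

text \<open>Split repeatedly, keeping one half \<open>R (Suc k)\<close> of \<open>R k\<close> for
  the next split; the discarded halves are the required sets.\<close>

lemma disjoint_positive_sequence:
  assumes I: "ideal_on X I" and C: "C \<in> coideal X I"
    and nonmax: "\<forall>C\<in>coideal X I. \<not> maximal_ideal C (restrict_ideal I C)"
  obtains E :: "nat \<Rightarrow> nat set"
  where "\<And>k. E k \<in> coideal X I" "\<And>k. E k \<subseteq> C" "disjoint_family E"
proof -
  have "\<exists>R. \<forall>k. (R k \<in> coideal X I \<and> R k \<subseteq> C) \<and>
      (R (Suc k) \<subseteq> R k \<and> R k - R (Suc k) \<in> coideal X I)"
  proof (rule dependent_nat_choice)
    show "\<exists>R. R \<in> coideal X I \<and> R \<subseteq> C"
      using C by blast
    fix R :: "nat set" and k :: nat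
    assume R: "R \<in> coideal X I \<and> R \<subseteq> C"
    then obtain D where "D \<subseteq> R" "D \<in> coideal X I" "R - D \<in> coideal X I"
      using split_positive[OF I] nonmax by metis
    with R show "\<exists>D. (D \<in> coideal X I \<and> D \<subseteq> C) \<and> D \<subseteq> R \<and> R - D \<in> coideal X I"
      by blast
  qed
  then obtain R where R: "\<And>k. R k \<subseteq> C" "\<And>k. R (Suc k) \<subseteq> R k"
      "\<And>k. R k - R (Suc k) \<in> coideal X I"
    by blast
  have "antimono R"
    using R(2) by (simp add: antimono_iff_le_Suc)
  \<comment> \<open>A later discarded half lies in \<open>R (Suc m)\<close>, which is exactly what
    the \<open>m\<close>-th one avoids.\<close>
  then have "R n \<subseteq> R (Suc m)" if "m < n" for m n
    using that by (auto dest: antimonoD[of R "Suc m" n])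
  then have "(R m - R (Suc m)) \<inter> (R n - R (Suc n)) = {}" if "m \<noteq> n" for m n
    using that by (cases m n rule: linorder_cases) blast+
  then show thesis
    using R by (intro that[of "\<lambda>k. R k - R (Suc k)"]) (auto simp: disjoint_family_on_def)
qed

section \<open>An almost disjoint family of size continuum\<close>

lemma almost_disjoint_continuum:
  obtains D :: "real \<Rightarrow> nat set"
  where "\<And>x. infinite (D x)" "\<And>x y. x \<noteq> y \<Longrightarrow> finite (D x \<inter> D y)"
proof
  \<comment> \<open>\<open>range (d x)\<close> codes the graph of the rounded line of slope
    \<open>x\<close>. Lines of different slopes drift apart, so their graphs share only finitely
    many points.\<close>
  define d where "d x n = to_nat (n, \<lfloor>x * real n\<rfloor>)" for x :: real and n :: nat
  have "inj (d x)" for x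
    by (auto simp: inj_on_def d_def)
  then show "infinite (range (d x))" for x
    using finite_imageD by blast
  show "finite (range (d x) \<inter> range (d y))" if "x \<noteq> y" for x y
  proof -
    \<comment> \<open>The first coordinate of a code is its index, so a common code has the same
      index \<open>n\<close> in both graphs. Equal floors then force
      \<open>\<bar>x - y\<bar> * real n < 1\<close>.\<close>
    have "range (d x) \<inter> range (d y) \<subseteq> d x ` {n. real n \<le> 1 / \<bar>x - y\<bar>}"
    proof clarify
      fix m n
      assume "d x m = d y n"
      then have "n = m" "\<lfloor>x * real m\<rfloor> = \<lfloor>y * real m\<rfloor>"
        by (auto simp: d_def)
      then have "\<bar>x * real m - y * real m\<bar> < 1"
        by linarith
      then have "\<bar>x - y\<bar> * real m < 1"
        by (simp add: left_diff_distrib[symmetric] abs_mult)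
      then have "real m \<le> 1 / \<bar>x - y\<bar>"
        using that by (simp add: field_simps)
      then show "d x m \<in> d x ` {n. real n \<le> 1 / \<bar>x - y\<bar>}"
        by simp
    qed
    moreover have "finite {n. real n \<le> 1 / \<bar>x - y\<bar>}"
      by (rule finite_subset[of _ "{..nat \<lfloor>1 / \<bar>x - y\<bar>\<rfloor>}"]) (auto simp: le_nat_floor)
    ultimately show ?thesis
      by (rule finite_subset[OF _ finite_imageI])
  qed
qed

section \<open>Coordinate functionals; consequences of lineability and spaceability\<close>

lemma abs_seq_le_norm: "\<bar>seq a n\<bar> \<le> norm a"
  unfolding norm_ell1_def
  using sum_le_suminf[OF summable_abs_seq[of a], of "{n}"] by simp

text \<open>Supplies the continuity of coordinates from which closedness of the subspace
  \<open>V\<close> below follows.\<close>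

lemma bounded_linear_seq: "bounded_linear (\<lambda>a. seq a n)"
  by (rule bounded_linear_intro[where K = 1]) (simp_all add: abs_seq_le_norm)

lemmas continuous_on_seq [continuous_intros] = bounded_linear.continuous_on[OF bounded_linear_seq]

lemma seq_sum: "seq (\<Sum>i\<in>A. f i) n = (\<Sum>i\<in>A. seq (f i) n)"
  by (induction A rule: infinite_finite_induct) simp_all

text \<open>With \<open>Y\<close> empty only the zero space is left, and it is the span of the empty
  set.\<close>

lemma spaceable_imp_nonempty:
  fixes Y :: "'a::real_normed_vector set"
  assumes "spaceable Y"
  shows "Y \<noteq> {}"
proof
  assume "Y = {}"
  with assms obtain V :: "'a set" where "subspace V" "V \<subseteq> {0}" "\<nexists>B. finite B \<and> span B = V"
    unfolding spaceable_def by blast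
  moreover from this have "V = {0}"
    using subspace_0 by blast
  ultimately show False
    by (metis finite.emptyI span_empty)
qed

lemma lineable_imp_nonempty:
  fixes Y :: "'a::real_vector set"
  assumes "lineable (UNIV :: real set) Y"
  shows "Y \<noteq> {}"
proof
  assume "Y = {}"
  with assms obtain B :: "'a set"
    where B: "span B \<subseteq> {0}" "independent B" "B \<approx> (UNIV :: real set)"
    by (auto simp: lineable_def)
  have "B \<noteq> {}"
    using eqpoll_finite_iff[OF B(3)] infinite_UNIV_char_0 by auto
  then obtain b where "b \<in> B"
    by blast
  moreover from this have "b = 0"
    using B(1) span_superset[of B] by blast
  ultimately show False
    using B(2) dependent_zero by blast
qed

lemma lineable_mono: "lineable K Y \<Longrightarrow> Y \<subseteq> Z \<Longrightarrow> lineable K Z"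
  unfolding lineable_def by blast

lemma spaceable_mono: "spaceable Y \<Longrightarrow> Y \<subseteq> Z \<Longrightarrow> spaceable Z"
  unfolding spaceable_def by blast

section \<open>The closed subspace and its independent family\<close>

lemma summable_positive_imp_lineable_spaceable:
  assumes I: "ideal_on {1..} I"
    and nonmax: "\<forall>C\<in>coideal {1..} I. \<not> maximal_ideal C (restrict_ideal I C)"
    and "summable_ideal \<inter> coideal {1..} I \<noteq> {}"
  shows "lineable (UNIV :: real set) (AOS I)" "spaceable (AOS I)"
proof -
  obtain C where C: "C \<in> coideal {1..} I" "(\<lambda>n. 1 / real n) summable_on C"
    using assms(3) by (auto simp: summable_ideal_def)
  obtain E :: "nat \<Rightarrow> nat set"
    where E: "\<And>k. E k \<in> coideal {1..} I" "\<And>k. E k \<subseteq> C" and disj: "disjoint_family E"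
    using disjoint_positive_sequence[OF I C(1) nonmax] by blast
  have E_ne: "E k \<noteq> {}" for k
    using E(1)[of k] ideal_finite[OF I, of "{}"] by (auto simp: coideal_def)
  have E_pos: "n \<ge> 1" if "n \<in> E k" for n k
    using E(1)[of k] that by (auto simp: coideal_def)
  \<comment> \<open>Constancy on a piece is stated for pairs of indices, without naming the value.
    This presents \<open>V\<close> as an intersection of solution sets of equations between
    continuous functionals.\<close>
  define V where "V = {a. (\<forall>n. n \<notin> (\<Union>k. E k) \<longrightarrow> seq a n = 0) \<and>
    (\<forall>k. \<forall>m\<in>E k. \<forall>n\<in>E k. real m * seq a m = real n * seq a n)}"
  have V_zero: "seq a n = 0" if "a \<in> V" "n \<notin> (\<Union>k. E k)" for a n
    using that unfolding V_def by blast
  have V_const: "real m * seq a m = real n * seq a n" if "a \<in> V" "m \<in> E k" "n \<in> E k" for a k m n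
    using that unfolding V_def by blast
  have V_I: "a \<in> V" if "\<And>n. n \<notin> (\<Union>k. E k) \<Longrightarrow> seq a n = 0"
    "\<And>k m n. m \<in> E k \<Longrightarrow> n \<in> E k \<Longrightarrow> real m * seq a m = real n * seq a n" for a
    using that unfolding V_def by blast
  have subV: "subspace V"
  proof (rule subspaceI)
    show "0 \<in> V"
      by (rule V_I) simp_all
    show "a + b \<in> V" if "a \<in> V" "b \<in> V" for a b
    proof (rule V_I)
      show "seq (a + b) n = 0" if "n \<notin> (\<Union>k. E k)" for n
        using V_zero[OF \<open>a \<in> V\<close> that] V_zero[OF \<open>b \<in> V\<close> that] by simp
      show "real m * seq (a + b) m = real n * seq (a + b) n" if "m \<in> E k" "n \<in> E k" for k m n
        using V_const[OF \<open>a \<in> V\<close> that] V_const[OF \<open>b \<in> V\<close> that] by (simp add: distrib_left)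
    qed
    show "c *\<^sub>R a \<in> V" if "a \<in> V" for c a
    proof (rule V_I)
      show "seq (c *\<^sub>R a) n = 0" if "n \<notin> (\<Union>k. E k)" for n
        using V_zero[OF \<open>a \<in> V\<close> that] by simp
      show "real m * seq (c *\<^sub>R a) m = real n * seq (c *\<^sub>R a) n" if "m \<in> E k" "n \<in> E k" for k m n
        using V_const[OF \<open>a \<in> V\<close> that] by (simp add: mult.left_commute[of _ c])
    qed
  qed
  have "V = (\<Inter>n\<in>-(\<Union>k. E k). {a. seq a n = 0}) \<inter>
      (\<Inter>k. \<Inter>m\<in>E k. \<Inter>n\<in>E k. {a. real m * seq a m = real n * seq a n})"
    unfolding V_def by blast
  also have "closed \<dots>"
    by (intro closed_Int closed_INT ballI closed_Collect_eq continuous_intros)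
  finally have closedV: "closed V" .
  have V_AOS: "V \<subseteq> AOS I \<union> {0}"
  proof
    fix a
    assume a: "a \<in> V"
    show "a \<in> AOS I \<union> {0}"
    proof (cases "a = 0")
      case False
      then obtain m where m: "seq a m \<noteq> 0"
        by (metis ell1_eqI seq_zero)
      then obtain k where k: "m \<in> E k"
        using V_zero[OF a] by blast
      \<comment> \<open>\<open>c\<close> is the constant value of
        \<open>\<bar>real n * seq a n\<bar>\<close> on the piece \<open>E k\<close>, so the level
        set at \<open>c\<close> contains that whole positive piece.\<close>
      define c where "c = \<bar>real m * seq a m\<bar>"
      have "c > 0"
        using m E_pos[OF k] by (simp add: c_def)
      have "E k \<subseteq> {n \<in> {1..}. \<bar>real n * seq a n\<bar> \<ge> c}"
      proof
        fix n
        assume "n \<in> E k"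
        moreover from this have "real n * seq a n = real m * seq a m"
          by (rule V_const[OF a _ k])
        ultimately show "n \<in> {n \<in> {1..}. \<bar>real n * seq a n\<bar> \<ge> c}"
          using E_pos by (simp add: c_def)
      qed
      moreover have "E k \<notin> I"
        using E(1) by (simp add: coideal_def)
      ultimately have "{n \<in> {1..}. \<bar>real n * seq a n\<bar> \<ge> c} \<notin> I"
        using ideal_subset[OF I] by blast
      with \<open>c > 0\<close> show ?thesis
        by (auto simp: AOS_def ideal_null_def)
    qed simp
  qed
  obtain D :: "real \<Rightarrow> nat set"
    where D: "\<And>x. infinite (D x)" "\<And>x y. x \<noteq> y \<Longrightarrow> finite (D x \<inter> D y)"
    using almost_disjoint_continuum by blast
  define S where "S x = (\<Union>k\<in>D x. E k)" for x
  have S_iff: "n \<in> S x \<longleftrightarrow> k \<in> D x" if "n \<in> E k" for n k x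
  proof -
    have "j = k" if "n \<in> E j" for j
      using \<open>n \<in> E k\<close> that disj unfolding disjoint_family_on_def by blast
    with that show ?thesis
      unfolding S_def by blast
  qed
  \<comment> \<open>The weight \<open>1 / real n\<close> turns \<open>real n * seq (e x) n\<close>
    into the indicator of \<open>S x\<close>; it is summable since \<open>S x\<close> lies in
    \<open>C\<close>.\<close>
  define e where "e x = Abs_ell1 (\<lambda>n. if n \<in> S x then 1 / real n else 0)" for x
  have seq_e: "seq (e x) n = (if n \<in> S x then 1 / real n else 0)" for x n
  proof -
    have "S x \<subseteq> C"
      using E(2) by (auto simp: S_def)
    then have "(\<lambda>n. 1 / real n) summable_on S x"
      by (rule summable_on_subset_banach[OF C(2)])
    also have "?this \<longleftrightarrow> (\<lambda>n. if n \<in> S x then 1 / real n else 0) summable_on UNIV"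
      by (rule summable_on_cong_neutral) auto
    finally have "summable (\<lambda>n. \<bar>if n \<in> S x then 1 / real n else 0\<bar>)"
      by (subst (asm) summable_on_UNIV_nonneg_real_iff) (auto cong: if_cong)
    \<comment> \<open>At index 0 both branches vanish, because \<open>1 / real 0 = 0\<close>; hence
      the function meets the normalisation of \<open>ell1\<close>.\<close>
    then show ?thesis
      unfolding e_def by (subst Abs_ell1_inverse) auto
  qed
  have e_V: "e x \<in> V" for x
  proof -
    have "seq (e x) n = 0" if "n \<notin> (\<Union>k. E k)" for n
      using that by (auto simp: S_def seq_e)
    moreover have "real m * seq (e x) m = real n * seq (e x) n" if "m \<in> E k" "n \<in> E k" for k m n
      using that E_pos[of m k] E_pos[of n k] by (simp add: seq_e S_iff)
    ultimately show ?thesis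
      by (rule V_I)
  qed
  have seq_e_E: "seq (e x) n \<noteq> 0 \<longleftrightarrow> k \<in> D x" if "n \<in> E k" for x n k
    using that E_pos[OF that] by (simp add: seq_e S_iff)
  \<comment> \<open>The infinite set \<open>D x\<close> meets finitely many other \<open>D y\<close>
    in a finite set altogether. Any coordinate in a piece \<open>E k\<close> with \<open>k\<close>
    in the rest of \<open>D x\<close> works.\<close>
  have isolate: "\<exists>n. seq (e x) n \<noteq> 0 \<and> (\<forall>y\<in>T. seq (e y) n = 0)" if "finite T" "x \<notin> T" for x T
  proof -
    have "finite (\<Union>y\<in>T. D x \<inter> D y)"
    proof (rule finite_UN_I)
      show "finite (D x \<inter> D y)" if "y \<in> T" for y
        using that \<open>x \<notin> T\<close> by (intro D(2)) auto
    qed fact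
    then have "\<not> D x \<subseteq> (\<Union>y\<in>T. D x \<inter> D y)"
      using D(1) finite_subset by blast
    then obtain k where k: "k \<in> D x" "\<And>y. y \<in> T \<Longrightarrow> k \<notin> D y"
      by blast
    obtain n where "n \<in> E k"
      using E_ne by blast
    with k show ?thesis
      using seq_e_E by blast
  qed
  have inj_e: "inj e"
  proof (rule injI, rule ccontr)
    fix x y
    assume "e x = e y" "x \<noteq> y"
    with isolate[of "{y}" x] show False
      by auto
  qed
  have ind: "independent (range e)"
  proof
    assume "dependent (range e)"
    then obtain t u w
      where t: "finite t" "t \<subseteq> range e" "(\<Sum>v\<in>t. u v *\<^sub>R v) = 0" and w: "w \<in> t" "u w \<noteq> 0"
      unfolding dependent_explicit by blast
    then obtain v where v: "e v \<in> t" "u (e v) \<noteq> 0"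
      by blast
    obtain T where T: "t = e ` T" "finite T"
      using finite_subset_image[OF t(1,2)] by blast
    have "finite (T - {v})"
      using T by simp
    then obtain n where n: "seq (e v) n \<noteq> 0" "\<And>y. y \<in> T - {v} \<Longrightarrow> seq (e y) n = 0"
      using isolate[of "T - {v}" v] by auto
    \<comment> \<open>Evaluating the vanishing combination at the isolated coordinate
      \<open>n\<close> leaves only the term of \<open>e v\<close>, whose coefficient is
      nonzero.\<close>
    have "0 = seq (\<Sum>w\<in>t. u w *\<^sub>R w) n"
      using t(3) by simp
    also have "\<dots> = (\<Sum>w\<in>t. u w * seq w n)"
      by (simp add: seq_sum)
    also have "\<dots> = (\<Sum>w\<in>{e v}. u w * seq w n)"
    proof (rule sum.mono_neutral_right)
      show "\<forall>w\<in>t - {e v}. u w * seq w n = 0"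
        using n(2) T(1) by auto
    qed (use t v in auto)
    finally show False
      using n(1) v(2) by simp
  qed
  have span_V: "span (range e) \<subseteq> V"
    using e_V subV by (intro span_minimal) auto
  have "range e \<approx> (UNIV :: real set)"
    using inj_e by (auto simp: eqpoll_def intro: bij_betw_inv_into inj_on_imp_bij_betw)
  then show "lineable (UNIV :: real set) (AOS I)"
    unfolding lineable_def using ind span_V V_AOS subspace_span by blast
  \<comment> \<open>The infinite independent set \<open>range e\<close> lies in \<open>V\<close>, so
    no finite set can span \<open>V\<close>.\<close>
  have "\<nexists>B. finite B \<and> span B = V"
  proof clarify
    fix B
    assume B: "finite B" "V = span B"
    have "finite (range e)"
      using independent_span_bound[OF B(1) ind] e_V B(2) by auto
    then show False
      using inj_e finite_imageD infinite_UNIV_char_0 by blast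
  qed
  then show "spaceable (AOS I)"
    unfolding spaceable_def using subV closedV V_AOS by blast
qed

theorem theorem4p4:
  fixes I :: "nat set set"
  assumes "ideal_on {1..} I"
    and "\<forall>C\<in>coideal {1..} I. \<not> maximal_ideal C (restrict_ideal I C)"
  shows "(AOS I \<noteq> {} \<longleftrightarrow> AOS_star I \<noteq> {}) \<and>
         (AOS_star I \<noteq> {} \<longleftrightarrow> lineable (UNIV :: real set) (AOS I)) \<and>
         (lineable (UNIV :: real set) (AOS I) \<longleftrightarrow> lineable (UNIV :: real set) (AOS_star I)) \<and>
         (lineable (UNIV :: real set) (AOS_star I) \<longleftrightarrow> spaceable (AOS I)) \<and>
         (spaceable (AOS I) \<longleftrightarrow> spaceable (AOS_star I)) \<and>
         (spaceable (AOS_star I) \<longleftrightarrow> summable_ideal \<inter> coideal {1..} I \<noteq> {})"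
proof -
  \<comment> \<open>Every other condition is compared with \<open>?P\<close>: each forces
    \<open>AOS_star I\<close> to be nonempty and hence gives \<open>?P\<close>, while
    \<open>?P\<close> gives the strong properties of \<open>AOS I\<close>, which pass up to
    \<open>AOS_star I\<close>.\<close>
  let ?P = "summable_ideal \<inter> coideal {1..} I \<noteq> {}"
  note positive = AOS_star_imp_summable_positive[OF assms(1)]
  note large = summable_positive_imp_lineable_spaceable[OF assms]
  note sub = AOS_subset_AOS_star[OF assms(1)]
  have "AOS I \<noteq> {} \<longleftrightarrow> ?P"
    using positive sub large(2) spaceable_imp_nonempty by blast
  moreover have "AOS_star I \<noteq> {} \<longleftrightarrow> ?P"
    using positive sub large(2) spaceable_imp_nonempty by blast
  moreover have "lineable (UNIV :: real set) (AOS I) \<longleftrightarrow> ?P"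
    using positive sub large(1) lineable_imp_nonempty by blast
  moreover have "lineable (UNIV :: real set) (AOS_star I) \<longleftrightarrow> ?P"
    using positive lineable_mono[OF large(1) sub] lineable_imp_nonempty by blast
  moreover have "spaceable (AOS I) \<longleftrightarrow> ?P"
    using positive sub large(2) spaceable_imp_nonempty by blast
  moreover have "spaceable (AOS_star I) \<longleftrightarrow> ?P"
    using positive spaceable_mono[OF large(2) sub] spaceable_imp_nonempty by blast
  ultimately show ?thesis
    by (simp only:)
qed

end
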